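(* If a complete implicative-ortholattice admits a full Sasaki set of projections, then its associated orthogonality space is a Sasaki space.
   Context: A BE algebra is an algebra $(X,\to,1)$ such that for all $x,y,z\in X$: $x\to x=1$; $x\to 1=1$; $1\to x=x$; $x\to(y\to z)=y\to(x\to z)$. It carries the relation $x\le y$ iff $x\to y=1$. It is bounded if there is $0\in X$ with $0\le x$ for all $x\in X$; then $x^*:=x\to 0$ (so $0=1^*$) and the algebra is written $(X,\to,{}^*,1)$. It is involutive if $x^{**}=x$ for all $x$, and implicative if $(x\to y)\to x=x$ for all $x,y$. An implicative-ortholattice is an implicative involutive (bounded) BE algebra. In an implicative-ortholattice the relation $x\le_L y$ iff $x=(x\to y^* )^*$ is a bounded lattice order, with meet $(x\to y^* )^*$ and join $x^*\to y$; $X$ is called complete if this lattice is complete. A set $S$ of maps $X\to X$ is a Sasaki set of projections on an implicative-ortholattice $X$ if: (1) for each $\varphi\in S$ and all $x,y\in X$, $x\le_L y$ implies $\varphi x\le_L\varphi y$; (2) for $\varphi,\psi\in S$, $\varphi 1\le_L\psi 1$ implies $\varphi\circ\psi=\varphi$; (3) for each $\varphi\in S$ and all $x\in X$, $\varphi((\varphi x)^* )\le_L x^*$. It is full if for each $x\in X$ there exists $\varphi^x\in S$ with $\varphi^x 1=x$. An orthogonality space is a set with a symmetric irreflexive relation $\perp$. The associated orthogonality space of an implicative-ortholattice $X$ is $X'=X\setminus\{0\}$ with $x\perp y$ iff $x^*=x\to y$. For $A\subseteq X'$, $A^\perp=\{x\in X'\mid x\perp a\text{ for all }a\in A\}$;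 $A$ is orthoclosed if $A=A^{\perp\perp}$; $\complement A^\perp=X'\setminus A^\perp$. For an orthoclosed $A\subseteq X'$, a Sasaki map to $A$ is a map $\varphi:\complement A^\perp\to A$ such that $\varphi x=x$ for all $x\in A$, and for all $x,y\in\complement A^\perp$, $\varphi x\perp y$ iff $x\perp\varphi y$. $(X',\perp)$ is a Sasaki space if for every orthoclosed $A\subseteq X'$ there exists a Sasaki map to $A$. *)

theory Defs
  imports "HOL-Algebra.Complete_Lattice" "HOL-Library.FuncSet"
begin

text \<open>
  Algebras are given by an explicit carrier set; the operations are total functions on the
  surrounding type, constrained on the carrier only.
\<close>

locale BE_algebra =
  fixes X :: "'a set"
    and imp :: "'a \<Rightarrow> 'a \<Rightarrow> 'a" (infixr "\<^bold>\<rightarrow>" 60)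
    and one :: 'a ("\<^bold>1")
  assumes one_closed: "\<^bold>1 \<in> X"
    and imp_closed: "\<lbrakk>x \<in> X; y \<in> X\<rbrakk> \<Longrightarrow> x \<^bold>\<rightarrow> y \<in> X"
    and imp_refl: "x \<in> X \<Longrightarrow> x \<^bold>\<rightarrow> x = \<^bold>1"
    and imp_one: "x \<in> X \<Longrightarrow> x \<^bold>\<rightarrow> \<^bold>1 = \<^bold>1"
    and one_imp: "x \<in> X \<Longrightarrow> \<^bold>1 \<^bold>\<rightarrow> x = x"
    and exchange: "\<lbrakk>x \<in> X; y \<in> X; z \<in> X\<rbrakk> \<Longrightarrow> x \<^bold>\<rightarrow> (y \<^bold>\<rightarrow> z) = y \<^bold>\<rightarrow> (x \<^bold>\<rightarrow> z)"
begin

definition be_le :: "'a \<Rightarrow> 'a \<Rightarrow> bool"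
  where "be_le x y \<longleftrightarrow> x \<^bold>\<rightarrow> y = \<^bold>1"

end

text \<open>
  The relation \<open>be_le\<close> of a BE algebra need not be antisymmetric, so the least element is not
  determined by the algebra and is a parameter.
\<close>

locale bounded_BE_algebra = BE_algebra +
  fixes zero :: 'a ("\<^bold>0")
  assumes zero_closed: "\<^bold>0 \<in> X"
    and zero_le: "x \<in> X \<Longrightarrow> be_le \<^bold>0 x"
begin

definition star :: "'a \<Rightarrow> 'a"
  where "star x = x \<^bold>\<rightarrow> \<^bold>0"

end

locale involutive_BE_algebra = bounded_BE_algebra +
  assumes star_star: "x \<in> X \<Longrightarrow> star (star x) = x"

locale implicative_ortholattice = involutive_BE_algebra +
  assumes implicative: "\<lbrakk>x \<in> X; y \<in> X\<rbrakk> \<Longrightarrow> (x \<^bold>\<rightarrow> y) \<^bold>\<rightarrow> x = x"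
begin

definition leL :: "'a \<Rightarrow> 'a \<Rightarrow> bool"  (infix "\<le>\<^sub>L" 50)
  where "x \<le>\<^sub>L y \<longleftrightarrow> x = star (x \<^bold>\<rightarrow> star y)"

definition order_L :: "'a gorder"
  where "order_L = \<lparr>carrier = X, eq = (=), le = (\<le>\<^sub>L)\<rparr>"

text \<open>Maps on the carrier are compared on the carrier only, as in the second axiom.\<close>

definition sasaki_set :: "('a \<Rightarrow> 'a) set \<Rightarrow> bool"
  where "sasaki_set S \<longleftrightarrow>
    S \<subseteq> X \<rightarrow> X \<and>
    (\<forall>\<phi>\<in>S. \<forall>x\<in>X. \<forall>y\<in>X. x \<le>\<^sub>L y \<longrightarrow> \<phi> x \<le>\<^sub>L \<phi> y) \<and>
    (\<forall>\<phi>\<in>S. \<forall>\<psi>\<in>S. \<phi> \<^bold>1 \<le>\<^sub>L \<psi> \<^bold>1 \<longrightarrow> (\<forall>x\<in>X. (\<phi> \<circ> \<psi>) x = \<phi> x)) \<and>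
    (\<forall>\<phi>\<in>S. \<forall>x\<in>X. \<phi> (star (\<phi> x)) \<le>\<^sub>L star x)"

definition full :: "('a \<Rightarrow> 'a) set \<Rightarrow> bool"
  where "full S \<longleftrightarrow> (\<forall>x\<in>X. \<exists>\<phi>\<in>S. \<phi> \<^bold>1 = x)"

definition nonzero :: "'a set"
  where "nonzero = X - {\<^bold>0}"

definition orthogonal :: "'a \<Rightarrow> 'a \<Rightarrow> bool"
  where "orthogonal x y \<longleftrightarrow> star x = x \<^bold>\<rightarrow> y"

lemma star_closed: "x \<in> X \<Longrightarrow> star x \<in> X"
  by (simp add: star_def imp_closed zero_closed)

lemma imp_star_commute: "\<lbrakk>x \<in> X; y \<in> X\<rbrakk> \<Longrightarrow> x \<^bold>\<rightarrow> star y = y \<^bold>\<rightarrow> star x"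
  by (simp add: star_def exchange zero_closed)

lemma leL_iff: "\<lbrakk>x \<in> X; y \<in> X\<rbrakk> \<Longrightarrow> x \<le>\<^sub>L y \<longleftrightarrow> star x = x \<^bold>\<rightarrow> star y"
  unfolding leL_def by (metis star_star star_closed imp_closed)

lemma imp_contract: "\<lbrakk>x \<in> X; y \<in> X\<rbrakk> \<Longrightarrow> x \<^bold>\<rightarrow> (x \<^bold>\<rightarrow> y) = x \<^bold>\<rightarrow> y"
  by (metis implicative imp_closed)

lemma leL_refl: "x \<in> X \<Longrightarrow> x \<le>\<^sub>L x"
  by (metis leL_iff star_def imp_contract zero_closed)

lemma leL_antisym: "\<lbrakk>x \<le>\<^sub>L y; y \<le>\<^sub>L x; x \<in> X; y \<in> X\<rbrakk> \<Longrightarrow> x = y"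
  unfolding leL_def by (metis imp_star_commute)

lemma leL_trans:
  assumes "x \<le>\<^sub>L y" "y \<le>\<^sub>L z" and X: "x \<in> X" "y \<in> X" "z \<in> X"
  shows "x \<le>\<^sub>L z"
proof -
  have xy: "star x = x \<^bold>\<rightarrow> star y" and yz: "star y = y \<^bold>\<rightarrow> star z"
    using assms leL_iff by auto
  have sx: "star x = y \<^bold>\<rightarrow> (x \<^bold>\<rightarrow> star z)"
    using xy yz X by (metis exchange star_closed)
  have "x \<^bold>\<rightarrow> star z = z \<^bold>\<rightarrow> (y \<^bold>\<rightarrow> (z \<^bold>\<rightarrow> star x))"
    using sx X by (metis imp_star_commute)
  also have "\<dots> = y \<^bold>\<rightarrow> (z \<^bold>\<rightarrow> star x)"
    using X by (metis exchange imp_contract imp_closed star_closed)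
  also have "\<dots> = star x"
    using sx X by (metis imp_star_commute)
  finally show ?thesis
    using X leL_iff by simp
qed

lemma partial_order_L: "partial_order order_L"
  by unfold_locales (auto simp: order_L_def intro: leL_refl leL_antisym leL_trans)

end

locale complete_implicative_ortholattice = implicative_ortholattice +
  assumes complete: "complete_lattice order_L"

locale orthogonality_space =
  fixes Y :: "'a set"
    and orth :: "'a \<Rightarrow> 'a \<Rightarrow> bool"
  assumes orth_sym: "\<lbrakk>x \<in> Y; y \<in> Y; orth x y\<rbrakk> \<Longrightarrow> orth y x"
    and orth_irrefl: "x \<in> Y \<Longrightarrow> \<not> orth x x"
begin

definition perp :: "'a set \<Rightarrow> 'a set"
  where "perp A = {x \<in> Y. \<forall>a\<in>A. orth x a}"

definition orthoclosed :: "'a set \<Rightarrow> bool"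
  where "orthoclosed A \<longleftrightarrow> A \<subseteq> Y \<and> A = perp (perp A)"

definition sasaki_map :: "'a set \<Rightarrow> ('a \<Rightarrow> 'a) \<Rightarrow> bool"
  where "sasaki_map A \<phi> \<longleftrightarrow>
    \<phi> \<in> (Y - perp A) \<rightarrow> A \<and>
    (\<forall>x\<in>A. \<phi> x = x) \<and>
    (\<forall>x \<in> Y - perp A. \<forall>y \<in> Y - perp A. orth (\<phi> x) y \<longleftrightarrow> orth x (\<phi> y))"

end

locale sasaki_space = orthogonality_space +
  assumes ex_sasaki_map: "orthoclosed A \<Longrightarrow> \<exists>\<phi>. sasaki_map A \<phi>"

end

theory Submission
  imports Defs
begin

text \<open>
  Orthogonality of \<open>x\<close> and \<open>y\<close> says \<open>x \<le>\<^sub>L star y\<close>, and \<open>star\<close> reverses the order. In a complete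
  lattice this makes every orthoclosed set a principal down-set without \<open>\<^bold>0\<close>: if \<open>a\<close> is the join
  of an orthoclosed \<open>A\<close>, then \<open>A\<close> consists of the nonzero elements below \<open>a\<close>, and \<open>perp A\<close> of the
  nonzero elements below \<open>star a\<close>.

  A Sasaki map to \<open>A\<close> is the restriction of a projection \<open>\<phi>\<close> from the full Sasaki set with
  \<open>\<phi> \<^bold>1 = a\<close>. Monotonicity and the third axiom make each projection self-adjoint:
  \<open>\<phi> x\<close> is orthogonal to \<open>y\<close> iff \<open>x\<close> is orthogonal to \<open>\<phi> y\<close>
  (\<open>sasaki_self_adjoint\<close>). The rest follows by taking adjoints. From \<open>\<phi> x = \<^bold>0\<close>,
  that is, \<open>\<phi> x\<close> orthogonal to \<open>\<^bold>1\<close>, it follows that \<open>x\<close> is orthogonal to \<open>a\<close>, so \<open>\<phi>\<close>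
  vanishes at no nonzero element outside \<open>perp A\<close>. The adjoint of the identity \<open>\<psi> \<circ> \<phi> = \<psi>\<close>,
  which the second axiom gives for \<open>\<psi> \<^bold>1 \<le>\<^sub>L \<phi> \<^bold>1\<close>, is \<open>\<phi> \<circ> \<psi> = \<psi>\<close>; evaluated at \<open>\<^bold>1\<close>
  with \<open>\<psi> \<^bold>1 = x\<close>, it shows that \<open>\<phi>\<close> fixes every \<open>x\<close> below \<open>a\<close> (\<open>sasaki_fixes_below\<close>).
\<close>

context implicative_ortholattice
begin

lemma star_one: "star \<^bold>1 = \<^bold>0"
  by (simp add: star_def one_imp zero_closed)

lemma leL_one: "x \<in> X \<Longrightarrow> x \<le>\<^sub>L \<^bold>1"
  by (simp add: leL_iff one_closed star_one) (simp add: star_def)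

lemma orthogonal_iff_leL_star:
  "\<lbrakk>x \<in> X; y \<in> X\<rbrakk> \<Longrightarrow> orthogonal x y \<longleftrightarrow> x \<le>\<^sub>L star y"
  by (simp add: orthogonal_def leL_iff star_closed star_star)

text \<open>
  With \<open>star x = x \<^bold>\<rightarrow> star y = y \<^bold>\<rightarrow> star x\<close>, the join \<open>star x \<^bold>\<rightarrow> y\<close> becomes
  \<open>(y \<^bold>\<rightarrow> star x) \<^bold>\<rightarrow> y\<close>, which the implicative law collapses to \<open>y\<close>.
\<close>

lemma star_antimono:
  assumes "x \<le>\<^sub>L y" and X: "x \<in> X" "y \<in> X"
  shows "star y \<le>\<^sub>L star x"
proof -
  have "star x = y \<^bold>\<rightarrow> star x"
    using assms by (metis leL_iff imp_star_commute)
  then have "star x \<^bold>\<rightarrow> y = y"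
    using X by (metis implicative star_closed)
  then have "star (star y) = star y \<^bold>\<rightarrow> star (star x)"
    using X by (metis imp_star_commute star_closed star_star)
  then show ?thesis
    using X by (simp add: leL_iff star_closed)
qed

lemma orthogonal_sym:
  "\<lbrakk>orthogonal x y; x \<in> X; y \<in> X\<rbrakk> \<Longrightarrow> orthogonal y x"
  using star_antimono[of x "star y"]
  by (simp add: orthogonal_iff_leL_star star_closed star_star)

lemma orthogonal_iff_leL_star_swap:
  "\<lbrakk>x \<in> X; y \<in> X\<rbrakk> \<Longrightarrow> orthogonal x y \<longleftrightarrow> y \<le>\<^sub>L star x"
  using orthogonal_sym[of x y] orthogonal_sym[of y x] orthogonal_iff_leL_star[of y x] by blast

lemma orthogonal_self_eq_zero:
  assumes "orthogonal x x" "x \<in> X"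
  shows "x = \<^bold>0"
proof -
  have "star x = \<^bold>1"
    using assms by (simp add: orthogonal_def imp_refl)
  then show ?thesis
    using star_star[OF assms(2)] star_one by simp
qed

lemma orthogonal_one_iff: "x \<in> X \<Longrightarrow> orthogonal x \<^bold>1 \<longleftrightarrow> x = \<^bold>0"
  by (metis imp_one orthogonal_def star_one star_star one_closed)

lemma orthogonality_space_nonzero: "orthogonality_space nonzero orthogonal"
  by unfold_locales (auto simp: nonzero_def intro: orthogonal_sym dest: orthogonal_self_eq_zero)

text \<open>
  Every upper bound has the form \<open>star z\<close>, so elements orthogonal to the same \<open>z\<close> have the same
  upper bounds. Adjoints are compared through this criterion.
\<close>

lemma eq_if_same_orthogonals:
  assumes "\<And>z. z \<in> X \<Longrightarrow> orthogonal x z \<longleftrightarrow> orthogonal y z" and X: "x \<in> X" "y \<in> X"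
  shows "x = y"
proof (rule leL_antisym[OF _ _ X])
  show "x \<le>\<^sub>L y" "y \<le>\<^sub>L x"
    using assms(1)[of "star x"] assms(1)[of "star y"] X
    by (simp_all add: orthogonal_iff_leL_star star_closed star_star leL_refl)
qed

lemma sasaki_closed: "\<lbrakk>sasaki_set S; \<phi> \<in> S; x \<in> X\<rbrakk> \<Longrightarrow> \<phi> x \<in> X"
  by (auto simp: sasaki_set_def)

lemma sasaki_mono:
  "\<lbrakk>sasaki_set S; \<phi> \<in> S; x \<in> X; y \<in> X; x \<le>\<^sub>L y\<rbrakk> \<Longrightarrow> \<phi> x \<le>\<^sub>L \<phi> y"
  by (auto simp: sasaki_set_def)

lemma sasaki_absorb:
  "\<lbrakk>sasaki_set S; \<phi> \<in> S; \<psi> \<in> S; \<psi> \<^bold>1 \<le>\<^sub>L \<phi> \<^bold>1; x \<in> X\<rbrakk> \<Longrightarrow> \<psi> (\<phi> x) = \<psi> x"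
  by (auto simp: sasaki_set_def)

text \<open>
  If \<open>y \<le>\<^sub>L star (\<phi> x)\<close>, monotonicity and the third axiom give
  \<open>\<phi> y \<le>\<^sub>L \<phi> (star (\<phi> x)) \<le>\<^sub>L star x\<close>. Applying this half also with \<open>x\<close> and \<open>y\<close> exchanged makes
  \<open>\<phi>\<close> self-adjoint.
\<close>

lemma sasaki_orthogonal_transfer:
  assumes S: "sasaki_set S" "\<phi> \<in> S" and X: "x \<in> X" "y \<in> X" and orth: "orthogonal (\<phi> x) y"
  shows "orthogonal x (\<phi> y)"
proof -
  note closed = sasaki_closed[OF S] star_closed
  have "y \<le>\<^sub>L star (\<phi> x)"
    using orth X closed by (simp add: orthogonal_iff_leL_star_swap)
  then have "\<phi> y \<le>\<^sub>L \<phi> (star (\<phi> x))"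
    by (rule sasaki_mono[OF S, rotated 2]) (simp_all add: X closed)
  moreover have "\<phi> (star (\<phi> x)) \<le>\<^sub>L star x"
    using S X by (auto simp: sasaki_set_def)
  ultimately have "\<phi> y \<le>\<^sub>L star x"
    by (rule leL_trans) (simp_all add: X closed)
  then show ?thesis
    using X closed by (simp add: orthogonal_iff_leL_star_swap)
qed

lemma sasaki_self_adjoint:
  assumes S: "sasaki_set S" "\<phi> \<in> S" and X: "x \<in> X" "y \<in> X"
  shows "orthogonal (\<phi> x) y \<longleftrightarrow> orthogonal x (\<phi> y)"
proof
  assume "orthogonal (\<phi> x) y"
  then show "orthogonal x (\<phi> y)"
    by (rule sasaki_orthogonal_transfer[OF S X])
next
  assume "orthogonal x (\<phi> y)"
  then have "orthogonal (\<phi> y) x"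
    using X sasaki_closed[OF S] by (simp add: orthogonal_sym)
  then have "orthogonal y (\<phi> x)"
    by (rule sasaki_orthogonal_transfer[OF S X(2,1)])
  then show "orthogonal (\<phi> x) y"
    using X sasaki_closed[OF S] by (simp add: orthogonal_sym)
qed

text \<open>Both maps are self-adjoint, so the adjoint of \<open>\<psi> \<circ> \<phi> = \<psi>\<close> is \<open>\<phi> \<circ> \<psi> = \<psi>\<close>.\<close>

lemma sasaki_fixes_range_of_smaller:
  assumes S: "sasaki_set S" "\<phi> \<in> S" "\<psi> \<in> S" and le: "\<psi> \<^bold>1 \<le>\<^sub>L \<phi> \<^bold>1" and X: "x \<in> X"
  shows "\<phi> (\<psi> x) = \<psi> x"
proof (rule eq_if_same_orthogonals)
  note closed = sasaki_closed[OF S(1)]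
  fix z assume z: "z \<in> X"
  have "orthogonal (\<phi> (\<psi> x)) z \<longleftrightarrow> orthogonal x (\<psi> (\<phi> z))"
    using S X z closed by (simp add: sasaki_self_adjoint)
  also have "\<psi> (\<phi> z) = \<psi> z"
    using S le z by (rule sasaki_absorb)
  also have "orthogonal x (\<psi> z) \<longleftrightarrow> orthogonal (\<psi> x) z"
    using S X z by (simp add: sasaki_self_adjoint)
  finally show "orthogonal (\<phi> (\<psi> x)) z \<longleftrightarrow> orthogonal (\<psi> x) z" .
qed (simp_all add: S X sasaki_closed[OF S(1)])

lemma sasaki_fixes_below:
  assumes "sasaki_set S" "full S" "\<phi> \<in> S" "x \<in> X" "x \<le>\<^sub>L \<phi> \<^bold>1"
  shows "\<phi> x = x"
proof -
  obtain \<psi> where "\<psi> \<in> S" "\<psi> \<^bold>1 = x"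
    using assms(2,4) unfolding full_def by blast
  then show ?thesis
    using sasaki_fixes_range_of_smaller[OF assms(1,3), of \<psi> "\<^bold>1"] assms(5) one_closed by simp
qed

text \<open>The adjoint form of \<open>orthogonal (\<phi> x) \<^bold>1\<close>, which says that \<open>\<phi> x\<close> vanishes.\<close>

lemma sasaki_eq_zeroD:
  assumes S: "sasaki_set S" "\<phi> \<in> S" and x: "x \<in> X" "\<phi> x = \<^bold>0"
  shows "orthogonal x (\<phi> \<^bold>1)"
  using sasaki_self_adjoint[OF S x(1) one_closed] orthogonal_one_iff x(2) zero_closed by simp

end

context complete_implicative_ortholattice
begin

lemma join_exists:
  assumes "A \<subseteq> X"
  obtains a where "a \<in> X" "\<And>y. y \<in> X \<Longrightarrow> a \<le>\<^sub>L y \<longleftrightarrow> (\<forall>z\<in>A. z \<le>\<^sub>L y)"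
proof -
  obtain a where a: "least order_L a (Upper order_L A)"
    using complete_lattice.sup_exists[OF complete, of A] assms by (auto simp: order_L_def)
  then have aX: "a \<in> X" and upper: "\<And>z. z \<in> A \<Longrightarrow> z \<le>\<^sub>L a"
    and lub: "\<And>y. y \<in> X \<Longrightarrow> \<forall>z\<in>A. z \<le>\<^sub>L y \<Longrightarrow> a \<le>\<^sub>L y"
    using assms by (auto simp: least_def Upper_def order_L_def)
  show thesis
  proof (rule that[OF aX])
    fix y assume y: "y \<in> X"
    have "z \<le>\<^sub>L y" if "a \<le>\<^sub>L y" "z \<in> A" for z
      using upper[OF that(2)] that(1) by (rule leL_trans) (use that(2) assms aX y in auto)
    then show "a \<le>\<^sub>L y \<longleftrightarrow> (\<forall>z\<in>A. z \<le>\<^sub>L y)"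
      using lub[OF y] by blast
  qed
qed

sublocale orthogonality_space nonzero orthogonal
  by (rule orthogonality_space_nonzero)

text \<open>
  An element is orthogonal to the join of \<open>A\<close> iff it is orthogonal to all of \<open>A\<close>. Whatever lies
  below the join is therefore orthogonal to all of \<open>perp A\<close>, hence in \<open>A\<close> if \<open>A\<close> is orthoclosed.
\<close>

lemma orthoclosed_principal:
  assumes A: "orthoclosed A"
  obtains a where "a \<in> X" "A = {x \<in> nonzero. x \<le>\<^sub>L a}" "perp A = {x \<in> nonzero. orthogonal x a}"
proof -
  have AY: "A \<subseteq> nonzero" and AA: "A = perp (perp A)"
    using A by (auto simp: orthoclosed_def)
  then have AX: "A \<subseteq> X"
    by (auto simp: nonzero_def)
  obtain a where a: "a \<in> X" and join: "\<And>y. y \<in> X \<Longrightarrow> a \<le>\<^sub>L y \<longleftrightarrow> (\<forall>z\<in>A. z \<le>\<^sub>L y)"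
    using join_exists[OF AX] by blast
  have orth_join: "orthogonal x a \<longleftrightarrow> (\<forall>z\<in>A. orthogonal x z)" if "x \<in> X" for x
  proof -
    have swap: "orthogonal x z \<longleftrightarrow> z \<le>\<^sub>L star x" if "z \<in> X" for z
      using \<open>x \<in> X\<close> that by (rule orthogonal_iff_leL_star_swap)
    show ?thesis
      using join[OF star_closed[OF that]] swap[OF a] swap AX by blast
  qed
  then have perp: "perp A = {x \<in> nonzero. orthogonal x a}"
    unfolding perp_def by (auto simp: nonzero_def)
  have "x \<in> A" if x: "x \<in> nonzero" "x \<le>\<^sub>L a" for x
  proof -
    have "orthogonal x y" if "y \<in> perp A" for y
    proof -
      have y: "y \<in> X" "orthogonal y a" and xX: "x \<in> X"
        using that x perp by (auto simp: nonzero_def)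
      then have "a \<le>\<^sub>L star y"
        using a by (simp add: orthogonal_iff_leL_star_swap)
      then have "x \<le>\<^sub>L star y"
        using leL_trans[OF x(2)] y(1) a xX star_closed by simp
      then show ?thesis
        using xX y by (simp add: orthogonal_iff_leL_star)
    qed
    then have "x \<in> perp (perp A)"
      using x(1) by (simp add: perp_def)
    then show ?thesis
      using AA by simp
  qed
  moreover have "z \<le>\<^sub>L a" if "z \<in> A" for z
    using join[OF a] leL_refl[OF a] that by blast
  ultimately have "A = {x \<in> nonzero. x \<le>\<^sub>L a}"
    using AY by blast
  with a perp show thesis
    using that by blast
qed

lemma sasaki_space_if_full_sasaki_set:
  assumes S: "sasaki_set S" and full: "full S"
  shows "sasaki_space nonzero orthogonal"
proof unfold_locales
  fix A assume "orthoclosed A"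
  then obtain a where a: "a \<in> X" and A: "A = {x \<in> nonzero. x \<le>\<^sub>L a}"
    and perp: "perp A = {x \<in> nonzero. orthogonal x a}"
    by (rule orthoclosed_principal)
  obtain \<phi> where \<phi>: "\<phi> \<in> S" "\<phi> \<^bold>1 = a"
    using full a unfolding full_def by blast
  have "\<phi> x \<in> A" if x: "x \<in> nonzero - perp A" for x
  proof -
    have xX: "x \<in> X"
      using x by (simp add: nonzero_def)
    have "\<phi> x \<noteq> \<^bold>0"
      using sasaki_eq_zeroD[OF S \<phi>(1) xX] \<phi>(2) x perp by auto
    moreover have "\<phi> x \<le>\<^sub>L a"
      using sasaki_mono[OF S \<phi>(1) xX one_closed leL_one[OF xX]] \<phi>(2) by simp
    ultimately show ?thesis
      using A sasaki_closed[OF S \<phi>(1) xX] by (simp add: nonzero_def)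
  qed
  moreover have "\<phi> x = x" if "x \<in> A" for x
    using that A \<phi> sasaki_fixes_below[OF S full] by (simp add: nonzero_def)
  ultimately have "sasaki_map A \<phi>"
    using sasaki_self_adjoint[OF S \<phi>(1)] unfolding sasaki_map_def by (simp add: nonzero_def)
  then show "\<exists>\<phi>. sasaki_map A \<phi>"
    by blast
qed

end

theorem proposition7p7:
  fixes X :: "'a set" and imp :: "'a \<Rightarrow> 'a \<Rightarrow> 'a" and one zero :: 'a
  assumes "complete_implicative_ortholattice X imp one zero"
    and "\<exists>S. implicative_ortholattice.sasaki_set X imp one zero S \<and>
             implicative_ortholattice.full X one S"
  shows "sasaki_space (implicative_ortholattice.nonzero X zero)
           (implicative_ortholattice.orthogonal imp zero)"
proof -
  interpret complete_implicative_ortholattice X imp one zero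
    by (rule assms(1))
  show ?thesis
    using assms(2) sasaki_space_if_full_sasaki_set by blast
qed

end
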